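(* Let $\mathbf{C}$ be a firm category. There is a bijection between $\mathrm{ISub}(\mathbf{C})$ and the set of monocoreflective tensor ideals of $\mathbf{C}$.
   Context: An object name also denotes its identity morphism. In a braided monoidal category $\mathbf{C}$ with tensor unit $I$, a subunit is a subobject $s \colon S \rightarrowtail I$ (equivalence class of monomorphisms, identified when they factor through each other) such that $s \otimes S \colon S \otimes S \to I \otimes S$ is an isomorphism; $\mathrm{ISub}(\mathbf{C})$ is the collection of subunits in $\mathbf{C}$ (size issues are disregarded). A category is firm when it is braided monoidal and $s \otimes T \colon S \otimes T \to I \otimes T$ is a monomorphism whenever $s \colon S \rightarrowtail I$ and $t \colon T \rightarrowtail I$ are subunits. A monocoreflective tensor ideal of a monoidal category $\mathbf{C}$ is a full replete subcategory $\mathbf{D}$ of $\mathbf{C}$ such that: (i) if $A \in \mathbf{C}$ and $B \in \mathbf{D}$, then $A \otimes B \in \mathbf{D}$; (ii) the inclusion $F \colon \mathbf{D} \hookrightarrow \mathbf{C}$ has a right adjoint $G \colon \mathbf{C} \to \mathbf{D}$; (iii) the component of the counit at the tensor unit $\varepsilon_I \colon F(G(I)) \to I$ is monic; (iv) $F(B) \otimes \varepsilon_I$ is invertible for all $B \in \mathbf{D}$. *)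

theory Defs
  imports Main
begin

section \<open>Categories, functors and adjunctions\<close>

record ('o, 'a) category =
  Obj :: "'o set"
  Arr :: "'a set"
  Dom :: "'a \<Rightarrow> 'o"
  Cod :: "'a \<Rightarrow> 'o"
  Ident :: "'o \<Rightarrow> 'a"
  Comp :: "'a \<Rightarrow> 'a \<Rightarrow> 'a"  (infixr "\<cdot>\<index>" 55)

definition hom :: "('o, 'a, 'm) category_scheme \<Rightarrow> 'o \<Rightarrow> 'o \<Rightarrow> 'a set"
  where "hom C X Y = {f \<in> Arr C. Dom C f = X \<and> Cod C f = Y}"

text \<open>Composition is written in the order of application: \<open>g \<cdot> f\<close> is \<open>g\<close> after \<open>f\<close>.\<close>

locale category =
  fixes C :: "('o, 'a, 'm) category_scheme" (structure)
  assumes Dom_in_Obj: "f \<in> Arr C \<Longrightarrow> Dom C f \<in> Obj C"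
    and Cod_in_Obj: "f \<in> Arr C \<Longrightarrow> Cod C f \<in> Obj C"
    and Ident_in_hom: "X \<in> Obj C \<Longrightarrow> Ident C X \<in> hom C X X"
    and Comp_in_hom: "f \<in> hom C X Y \<Longrightarrow> g \<in> hom C Y Z \<Longrightarrow> g \<cdot> f \<in> hom C X Z"
    and Comp_Ident: "f \<in> hom C X Y \<Longrightarrow> f \<cdot> Ident C X = f"
    and Ident_Comp: "f \<in> hom C X Y \<Longrightarrow> Ident C Y \<cdot> f = f"
    and Comp_assoc: "f \<in> hom C W X \<Longrightarrow> g \<in> hom C X Y \<Longrightarrow> h \<in> hom C Y Z \<Longrightarrow>
          (h \<cdot> g) \<cdot> f = h \<cdot> (g \<cdot> f)"

definition mono_arr :: "('o, 'a, 'm) category_scheme \<Rightarrow> 'a \<Rightarrow> bool"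
  where "mono_arr C m \<longleftrightarrow> m \<in> Arr C \<and>
    (\<forall>W \<in> Obj C. \<forall>f \<in> hom C W (Dom C m). \<forall>g \<in> hom C W (Dom C m).
      m \<cdot>\<^bsub>C\<^esub> f = m \<cdot>\<^bsub>C\<^esub> g \<longrightarrow> f = g)"

definition inverse_arrs :: "('o, 'a, 'm) category_scheme \<Rightarrow> 'a \<Rightarrow> 'a \<Rightarrow> bool"
  where "inverse_arrs C f g \<longleftrightarrow>
    f \<in> Arr C \<and> g \<in> hom C (Cod C f) (Dom C f) \<and>
    g \<cdot>\<^bsub>C\<^esub> f = Ident C (Dom C f) \<and> f \<cdot>\<^bsub>C\<^esub> g = Ident C (Cod C f)"

definition iso_arr :: "('o, 'a, 'm) category_scheme \<Rightarrow> 'a \<Rightarrow> bool"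
  where "iso_arr C f \<longleftrightarrow> (\<exists>g. inverse_arrs C f g)"

definition inv_arr :: "('o, 'a, 'm) category_scheme \<Rightarrow> 'a \<Rightarrow> 'a"
  where "inv_arr C f = (THE g. inverse_arrs C f g)"

record ('o1, 'a1, 'o2, 'a2) cat_functor =
  on_obj :: "'o1 \<Rightarrow> 'o2"
  on_arr :: "'a1 \<Rightarrow> 'a2"

definition is_functor ::
  "('o1, 'a1, 'm1) category_scheme \<Rightarrow> ('o2, 'a2, 'm2) category_scheme \<Rightarrow>
    ('o1, 'a1, 'o2, 'a2) cat_functor \<Rightarrow> bool"
  where "is_functor C D F \<longleftrightarrow>
    category C \<and> category D \<and>
    (\<forall>X \<in> Obj C. on_obj F X \<in> Obj D) \<and>
    (\<forall>f \<in> Arr C. on_arr F f \<in> hom D (on_obj F (Dom C f)) (on_obj F (Cod C f))) \<and>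
    (\<forall>X \<in> Obj C. on_arr F (Ident C X) = Ident D (on_obj F X)) \<and>
    (\<forall>f \<in> Arr C. \<forall>g \<in> Arr C. Cod C f = Dom C g \<longrightarrow>
      on_arr F (g \<cdot>\<^bsub>C\<^esub> f) = on_arr F g \<cdot>\<^bsub>D\<^esub> on_arr F f)"

definition id_functor :: "('o, 'a, 'o, 'a) cat_functor"
  where "id_functor = \<lparr>on_obj = (\<lambda>X. X), on_arr = (\<lambda>f. f)\<rparr>"

definition comp_functor ::
  "('o2, 'a2, 'o3, 'a3) cat_functor \<Rightarrow> ('o1, 'a1, 'o2, 'a2) cat_functor \<Rightarrow>
    ('o1, 'a1, 'o3, 'a3) cat_functor"
  where "comp_functor G F =
    \<lparr>on_obj = on_obj G \<circ> on_obj F, on_arr = on_arr G \<circ> on_arr F\<rparr>"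

definition nat_trans ::
  "('o1, 'a1, 'm1) category_scheme \<Rightarrow> ('o2, 'a2, 'm2) category_scheme \<Rightarrow>
    ('o1, 'a1, 'o2, 'a2) cat_functor \<Rightarrow> ('o1, 'a1, 'o2, 'a2) cat_functor \<Rightarrow>
    ('o1 \<Rightarrow> 'a2) \<Rightarrow> bool"
  where "nat_trans C D F G \<tau> \<longleftrightarrow>
    is_functor C D F \<and> is_functor C D G \<and>
    (\<forall>X \<in> Obj C. \<tau> X \<in> hom D (on_obj F X) (on_obj G X)) \<and>
    (\<forall>f \<in> Arr C. \<tau> (Cod C f) \<cdot>\<^bsub>D\<^esub> on_arr F f = on_arr G f \<cdot>\<^bsub>D\<^esub> \<tau> (Dom C f))"

text \<open>\<open>adjunction D C F G \<eta> \<epsilon>\<close>: the functor \<open>F : D \<rightarrow> C\<close> is left adjoint to \<open>G : C \<rightarrow> D\<close>,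
  with unit \<open>\<eta>\<close> and counit \<open>\<epsilon>\<close>.\<close>

definition adjunction ::
  "('o1, 'a1, 'm1) category_scheme \<Rightarrow> ('o2, 'a2, 'm2) category_scheme \<Rightarrow>
    ('o1, 'a1, 'o2, 'a2) cat_functor \<Rightarrow> ('o2, 'a2, 'o1, 'a1) cat_functor \<Rightarrow>
    ('o1 \<Rightarrow> 'a1) \<Rightarrow> ('o2 \<Rightarrow> 'a2) \<Rightarrow> bool"
  where "adjunction D C F G \<eta> \<epsilon> \<longleftrightarrow>
    is_functor D C F \<and> is_functor C D G \<and>
    nat_trans D D id_functor (comp_functor G F) \<eta> \<and>
    nat_trans C C (comp_functor F G) id_functor \<epsilon> \<and>
    (\<forall>B \<in> Obj D. \<epsilon> (on_obj F B) \<cdot>\<^bsub>C\<^esub> on_arr F (\<eta> B) = Ident C (on_obj F B)) \<and>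
    (\<forall>A \<in> Obj C. on_arr G (\<epsilon> A) \<cdot>\<^bsub>D\<^esub> \<eta> (on_obj G A) = Ident D (on_obj G A))"

section \<open>Subobjects\<close>

definition monos_into :: "('o, 'a, 'm) category_scheme \<Rightarrow> 'o \<Rightarrow> 'a set"
  where "monos_into C A = {m. mono_arr C m \<and> Cod C m = A}"

definition factors_through :: "('o, 'a, 'm) category_scheme \<Rightarrow> 'a \<Rightarrow> 'a \<Rightarrow> bool"
  where "factors_through C m n \<longleftrightarrow> (\<exists>h \<in> hom C (Dom C m) (Dom C n). n \<cdot>\<^bsub>C\<^esub> h = m)"

definition subobject_rel :: "('o, 'a, 'm) category_scheme \<Rightarrow> 'o \<Rightarrow> ('a \<times> 'a) set"
  where "subobject_rel C A = {(m, n). m \<in> monos_into C A \<and> n \<in> monos_into C A \<and>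
    factors_through C m n \<and> factors_through C n m}"

definition subobjects :: "('o, 'a, 'm) category_scheme \<Rightarrow> 'o \<Rightarrow> 'a set set"
  where "subobjects C A = monos_into C A // subobject_rel C A"

section \<open>Braided monoidal categories\<close>

record ('o, 'a) braided_data = "('o, 'a) category" +
  TensorO :: "'o \<Rightarrow> 'o \<Rightarrow> 'o"  (infixr "\<otimes>\<index>" 70)
  TensorA :: "'a \<Rightarrow> 'a \<Rightarrow> 'a"  (infixr "\<boxtimes>\<index>" 70)
  Unit :: "'o"  ("\<one>\<index>")
  Assoc :: "'o \<Rightarrow> 'o \<Rightarrow> 'o \<Rightarrow> 'a"
  LUnit :: "'o \<Rightarrow> 'a"
  RUnit :: "'o \<Rightarrow> 'a"
  Braid :: "'o \<Rightarrow> 'o \<Rightarrow> 'a"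

locale braided_monoidal_category = category C
  for C :: "('o, 'a, 'm) braided_data_scheme" (structure) +
  assumes TensorO_in_Obj: "X \<in> Obj C \<Longrightarrow> Y \<in> Obj C \<Longrightarrow> X \<otimes> Y \<in> Obj C"
    and Unit_in_Obj: "\<one> \<in> Obj C"
    and TensorA_in_hom: "f \<in> hom C X Y \<Longrightarrow> g \<in> hom C X' Y' \<Longrightarrow>
          f \<boxtimes> g \<in> hom C (X \<otimes> X') (Y \<otimes> Y')"
    and TensorA_Ident: "X \<in> Obj C \<Longrightarrow> Y \<in> Obj C \<Longrightarrow>
          Ident C X \<boxtimes> Ident C Y = Ident C (X \<otimes> Y)"
    and TensorA_Comp: "f \<in> hom C X Y \<Longrightarrow> g \<in> hom C Y Z \<Longrightarrow>
          f' \<in> hom C X' Y' \<Longrightarrow> g' \<in> hom C Y' Z' \<Longrightarrow>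
          (g \<cdot> f) \<boxtimes> (g' \<cdot> f') = (g \<boxtimes> g') \<cdot> (f \<boxtimes> f')"
    and Assoc_in_hom: "X \<in> Obj C \<Longrightarrow> Y \<in> Obj C \<Longrightarrow> Z \<in> Obj C \<Longrightarrow>
          Assoc C X Y Z \<in> hom C ((X \<otimes> Y) \<otimes> Z) (X \<otimes> (Y \<otimes> Z))"
    and Assoc_iso: "X \<in> Obj C \<Longrightarrow> Y \<in> Obj C \<Longrightarrow> Z \<in> Obj C \<Longrightarrow> iso_arr C (Assoc C X Y Z)"
    and Assoc_natural: "f \<in> hom C X X' \<Longrightarrow> g \<in> hom C Y Y' \<Longrightarrow> h \<in> hom C Z Z' \<Longrightarrow>
          Assoc C X' Y' Z' \<cdot> ((f \<boxtimes> g) \<boxtimes> h) = (f \<boxtimes> (g \<boxtimes> h)) \<cdot> Assoc C X Y Z"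
    and LUnit_in_hom: "X \<in> Obj C \<Longrightarrow> LUnit C X \<in> hom C (\<one> \<otimes> X) X"
    and LUnit_iso: "X \<in> Obj C \<Longrightarrow> iso_arr C (LUnit C X)"
    and LUnit_natural: "f \<in> hom C X Y \<Longrightarrow> LUnit C Y \<cdot> (Ident C \<one> \<boxtimes> f) = f \<cdot> LUnit C X"
    and RUnit_in_hom: "X \<in> Obj C \<Longrightarrow> RUnit C X \<in> hom C (X \<otimes> \<one>) X"
    and RUnit_iso: "X \<in> Obj C \<Longrightarrow> iso_arr C (RUnit C X)"
    and RUnit_natural: "f \<in> hom C X Y \<Longrightarrow> RUnit C Y \<cdot> (f \<boxtimes> Ident C \<one>) = f \<cdot> RUnit C X"
    and triangle: "X \<in> Obj C \<Longrightarrow> Y \<in> Obj C \<Longrightarrow>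
          (Ident C X \<boxtimes> LUnit C Y) \<cdot> Assoc C X \<one> Y = RUnit C X \<boxtimes> Ident C Y"
    and pentagon: "W \<in> Obj C \<Longrightarrow> X \<in> Obj C \<Longrightarrow> Y \<in> Obj C \<Longrightarrow> Z \<in> Obj C \<Longrightarrow>
          Assoc C W X (Y \<otimes> Z) \<cdot> Assoc C (W \<otimes> X) Y Z =
          (Ident C W \<boxtimes> Assoc C X Y Z) \<cdot> Assoc C W (X \<otimes> Y) Z \<cdot> (Assoc C W X Y \<boxtimes> Ident C Z)"
    and Braid_in_hom: "X \<in> Obj C \<Longrightarrow> Y \<in> Obj C \<Longrightarrow> Braid C X Y \<in> hom C (X \<otimes> Y) (Y \<otimes> X)"
    and Braid_iso: "X \<in> Obj C \<Longrightarrow> Y \<in> Obj C \<Longrightarrow> iso_arr C (Braid C X Y)"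
    and Braid_natural: "f \<in> hom C X X' \<Longrightarrow> g \<in> hom C Y Y' \<Longrightarrow>
          Braid C X' Y' \<cdot> (f \<boxtimes> g) = (g \<boxtimes> f) \<cdot> Braid C X Y"
    and hexagon: "X \<in> Obj C \<Longrightarrow> Y \<in> Obj C \<Longrightarrow> Z \<in> Obj C \<Longrightarrow>
          Assoc C Y Z X \<cdot> Braid C X (Y \<otimes> Z) \<cdot> Assoc C X Y Z =
          (Ident C Y \<boxtimes> Braid C X Z) \<cdot> Assoc C Y X Z \<cdot> (Braid C X Y \<boxtimes> Ident C Z)"
    and hexagon_inv: "X \<in> Obj C \<Longrightarrow> Y \<in> Obj C \<Longrightarrow> Z \<in> Obj C \<Longrightarrow>
          inv_arr C (Assoc C Z X Y) \<cdot> Braid C (X \<otimes> Y) Z \<cdot> inv_arr C (Assoc C X Y Z) =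
          (Braid C X Z \<boxtimes> Ident C Y) \<cdot> inv_arr C (Assoc C X Z Y) \<cdot> (Ident C X \<boxtimes> Braid C Y Z)"

section \<open>Subunits and firm categories\<close>

text \<open>A monomorphism representing a subunit.  The condition depends only on the subobject
  that \<open>s\<close> represents.\<close>

definition represents_subunit :: "('o, 'a, 'm) braided_data_scheme \<Rightarrow> 'a \<Rightarrow> bool"
  where "represents_subunit C s \<longleftrightarrow>
    s \<in> monos_into C \<one>\<^bsub>C\<^esub> \<and> iso_arr C (s \<boxtimes>\<^bsub>C\<^esub> Ident C (Dom C s))"

definition ISub :: "('o, 'a, 'm) braided_data_scheme \<Rightarrow> 'a set set"
  where "ISub C = {S \<in> subobjects C \<one>\<^bsub>C\<^esub>. \<exists>s \<in> S. represents_subunit C s}"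

locale firm_category = braided_monoidal_category C
  for C :: "('o, 'a, 'm) braided_data_scheme" (structure) +
  assumes firm: "represents_subunit C s \<Longrightarrow> represents_subunit C t \<Longrightarrow>
    mono_arr C (s \<boxtimes> Ident C (Dom C t))"

section \<open>Monocoreflective tensor ideals\<close>

text \<open>A subcategory is given by its set of objects and its set of arrows, so that equality of
  subcategories is equality of these pairs.\<close>

definition subcategory :: "('o, 'a, 'm) category_scheme \<Rightarrow> 'o set \<times> 'a set \<Rightarrow> bool"
  where "subcategory C D \<longleftrightarrow>
    fst D \<subseteq> Obj C \<and> snd D \<subseteq> Arr C \<and>
    (\<forall>f \<in> snd D. Dom C f \<in> fst D \<and> Cod C f \<in> fst D) \<and>
    (\<forall>X \<in> fst D. Ident C X \<in> snd D) \<and>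
    (\<forall>f \<in> snd D. \<forall>g \<in> snd D. Cod C f = Dom C g \<longrightarrow> g \<cdot>\<^bsub>C\<^esub> f \<in> snd D)"

definition full_subcategory :: "('o, 'a, 'm) category_scheme \<Rightarrow> 'o set \<times> 'a set \<Rightarrow> bool"
  where "full_subcategory C D \<longleftrightarrow> subcategory C D \<and>
    (\<forall>X \<in> fst D. \<forall>Y \<in> fst D. hom C X Y \<subseteq> snd D)"

definition replete_subcategory :: "('o, 'a, 'm) category_scheme \<Rightarrow> 'o set \<times> 'a set \<Rightarrow> bool"
  where "replete_subcategory C D \<longleftrightarrow> subcategory C D \<and>
    (\<forall>f. iso_arr C f \<and> Dom C f \<in> fst D \<longrightarrow> Cod C f \<in> fst D \<and> f \<in> snd D)"

definition subcat ::
  "('o, 'a, 'm) category_scheme \<Rightarrow> 'o set \<times> 'a set \<Rightarrow> ('o, 'a, 'm) category_scheme"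
  where "subcat C D = C\<lparr>Obj := fst D, Arr := snd D\<rparr>"

definition inclusion_functor :: "('o, 'a, 'o, 'a) cat_functor"
  where "inclusion_functor = \<lparr>on_obj = (\<lambda>X. X), on_arr = (\<lambda>f. f)\<rparr>"

text \<open>The last two conditions refer to the counit of the right adjoint in the second one; they
  do not depend on its choice, right adjoints being unique up to isomorphism.\<close>

definition monocoreflective_tensor_ideal ::
  "('o, 'a, 'm) braided_data_scheme \<Rightarrow> 'o set \<times> 'a set \<Rightarrow> bool"
  where "monocoreflective_tensor_ideal C D \<longleftrightarrow>
    full_subcategory C D \<and> replete_subcategory C D \<and>
    (\<forall>A \<in> Obj C. \<forall>B \<in> fst D. A \<otimes>\<^bsub>C\<^esub> B \<in> fst D) \<and>
    (let F = inclusion_functor in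
      \<exists>G \<eta> \<epsilon>. adjunction (subcat C D) C F G \<eta> \<epsilon> \<and>
        mono_arr C (\<epsilon> \<one>\<^bsub>C\<^esub>) \<and>
        (\<forall>B \<in> fst D. iso_arr C (Ident C (on_obj F B) \<boxtimes>\<^bsub>C\<^esub> \<epsilon> \<one>\<^bsub>C\<^esub>)))"

definition monocoreflective_tensor_ideals ::
  "('o, 'a, 'm) braided_data_scheme \<Rightarrow> ('o set \<times> 'a set) set"
  where "monocoreflective_tensor_ideals C = {D. monocoreflective_tensor_ideal C D}"

end

theory Submission
  imports Defs
begin

text \<open>A subunit \<open>s : S \<rightarrow> \<one>\<close> corresponds to the full subcategory on its support, the
  objects \<open>B\<close> with \<open>B \<otimes> s\<close> invertible; conversely an ideal corresponds to the component at
  \<open>\<one>\<close> of its counit.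

  The support is a tensor ideal because \<open>(A \<otimes> B) \<otimes> s\<close> is \<open>A \<otimes> (B \<otimes> s)\<close> up to
  associativity.  It is coreflective with right adjoint \<open>A \<mapsto> A \<otimes> S\<close>, and the counit is the
  contraction \<open>A \<otimes> S \<rightarrow> A \<otimes> \<one> \<rightarrow> A\<close>.  Contraction is invertible exactly on the support,
  so its inverse there is the unit, and the only triangle identity with content is that the two
  contractions \<open>(A \<otimes> S) \<otimes> S \<rightarrow> A \<otimes> S\<close> agree (\<open>contract_TensorO_Dom\<close>).  Moving
  everything into the last two factors reduces this to the two contractions \<open>S \<otimes> S \<rightarrow> S\<close>,
  which become equal after composing with the monomorphism \<open>s\<close>.  The reduction uses two
  coherence laws that are not among the axioms but follow from them by Kelly's arguments:
  \<open>RUnit_TensorO\<close> and \<open>LUnit_Unit_eq_RUnit_Unit\<close>.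

  The two assignments are mutually inverse.  If the domain of \<open>s\<close> lies in the support of \<open>t\<close>, then
  \<open>s\<close> factors through \<open>t\<close> (\<open>factors_through_if_Dom_in_support\<close>), so subunits with the same
  support are the same subobject.  For an ideal with counit component \<open>s\<close> at \<open>\<one>\<close>, every
  object of the ideal is supported on \<open>s\<close> by definition, and an object \<open>B\<close> supported on \<open>s\<close> is
  isomorphic to \<open>B \<otimes> S\<close>, which lies in the ideal since \<open>S\<close> does
  (\<open>monocoreflective_tensor_ideal_cases\<close>).\<close>

section \<open>Arrows, isomorphisms and subobjects\<close>

lemma in_hom_iff: "f \<in> hom C X Y \<longleftrightarrow> f \<in> Arr C \<and> Dom C f = X \<and> Cod C f = Y"
  by (auto simp: hom_def)

context category
begin

declare Dom_in_Obj [simp] Cod_in_Obj [simp]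

lemma Ident_simps [simp]:
  assumes "X \<in> Obj C"
  shows "Ident C X \<in> Arr C" "Dom C (Ident C X) = X" "Cod C (Ident C X) = X"
  using Ident_in_hom[OF assms] by (auto simp: in_hom_iff)

lemma Comp_simps [simp]:
  assumes "f \<in> Arr C" "g \<in> Arr C" "Dom C g = Cod C f"
  shows "g \<cdot> f \<in> Arr C" "Dom C (g \<cdot> f) = Dom C f" "Cod C (g \<cdot> f) = Cod C g"
  using Comp_in_hom[of f "Dom C f" "Cod C f" g "Cod C g"] assms by (auto simp: in_hom_iff)

lemma Comp_Ident_Dom [simp]: "f \<in> Arr C \<Longrightarrow> Dom C f = X \<Longrightarrow> f \<cdot> Ident C X = f"
  using Comp_Ident by (auto simp: in_hom_iff)

lemma Ident_Comp_Cod [simp]: "f \<in> Arr C \<Longrightarrow> Cod C f = X \<Longrightarrow> Ident C X \<cdot> f = f"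
  using Ident_Comp by (auto simp: in_hom_iff)

lemma Comp_assoc_Arr [simp]:
  assumes "f \<in> Arr C" "g \<in> Arr C" "h \<in> Arr C" "Dom C g = Cod C f" "Dom C h = Cod C g"
  shows "(h \<cdot> g) \<cdot> f = h \<cdot> (g \<cdot> f)"
  using Comp_assoc[of f "Dom C f" "Cod C f" g "Cod C g" h "Cod C h"] assms
  by (auto simp: in_hom_iff)

lemma inverse_arrs_unique:
  assumes "inverse_arrs C f g" "inverse_arrs C f h"
  shows "g = h"
proof -
  have "g = g \<cdot> (f \<cdot> h)" using assms by (auto simp: inverse_arrs_def in_hom_iff)
  also have "\<dots> = (g \<cdot> f) \<cdot> h"
    using assms by (subst Comp_assoc_Arr) (auto simp: inverse_arrs_def in_hom_iff)
  also have "\<dots> = h" using assms by (simp add: inverse_arrs_def in_hom_iff)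
  finally show ?thesis .
qed

lemma iso_arr_inverse_arrs: "iso_arr C f \<Longrightarrow> inverse_arrs C f (inv_arr C f)"
  unfolding iso_arr_def inv_arr_def by (blast intro: theI inverse_arrs_unique)

lemma iso_arr_Arr: "iso_arr C f \<Longrightarrow> f \<in> Arr C"
  by (auto simp: iso_arr_def inverse_arrs_def)

lemma inv_arr_simps [simp]:
  assumes "iso_arr C f"
  shows "inv_arr C f \<in> Arr C" "Dom C (inv_arr C f) = Cod C f" "Cod C (inv_arr C f) = Dom C f"
    "inv_arr C f \<cdot> f = Ident C (Dom C f)" "f \<cdot> inv_arr C f = Ident C (Cod C f)"
  using iso_arr_inverse_arrs[OF assms] by (auto simp: inverse_arrs_def in_hom_iff)

lemma iso_arrI:
  assumes "f \<in> Arr C" "g \<in> Arr C" "Dom C g = Cod C f" "Cod C g = Dom C f"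
    "g \<cdot> f = Ident C (Dom C f)" "f \<cdot> g = Ident C (Cod C f)"
  shows "iso_arr C f"
  using assms by (auto simp: iso_arr_def inverse_arrs_def in_hom_iff)

lemma iso_arr_Ident: "X \<in> Obj C \<Longrightarrow> iso_arr C (Ident C X)"
  by (rule iso_arrI[of _ "Ident C X"]) auto

lemma iso_arr_inv_arr: "iso_arr C f \<Longrightarrow> iso_arr C (inv_arr C f)"
  by (rule iso_arrI[of _ f]) (auto simp: iso_arr_Arr)

lemma inv_arr_Comp_Comp:
  assumes "iso_arr C f" "g \<in> Arr C" "Cod C g = Dom C f"
  shows "inv_arr C f \<cdot> (f \<cdot> g) = g"
proof -
  have "inv_arr C f \<cdot> (f \<cdot> g) = (inv_arr C f \<cdot> f) \<cdot> g"
    using assms by (subst Comp_assoc_Arr) (auto simp: iso_arr_Arr)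
  then show ?thesis using assms by simp
qed

lemma Comp_inv_arr_Comp:
  assumes "iso_arr C f" "g \<in> Arr C" "Cod C g = Cod C f"
  shows "f \<cdot> (inv_arr C f \<cdot> g) = g"
proof -
  have "f \<cdot> (inv_arr C f \<cdot> g) = (f \<cdot> inv_arr C f) \<cdot> g"
    using assms by (subst Comp_assoc_Arr) (auto simp: iso_arr_Arr)
  then show ?thesis using assms by simp
qed

lemma iso_arr_cancel_left:
  assumes "iso_arr C f" "g \<in> Arr C" "h \<in> Arr C" "Cod C g = Dom C f" "Cod C h = Dom C f"
    "f \<cdot> g = f \<cdot> h"
  shows "g = h"
  using inv_arr_Comp_Comp[of f g] inv_arr_Comp_Comp[of f h] assms by metis

lemma iso_arr_cancel_right:
  assumes f: "iso_arr C f" and g: "g \<in> Arr C" "Dom C g = Cod C f"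
    and h: "h \<in> Arr C" "Dom C h = Cod C f" and eq: "g \<cdot> f = h \<cdot> f"
  shows "g = h"
proof -
  have "k = (k \<cdot> f) \<cdot> inv_arr C f" if "k \<in> Arr C" "Dom C k = Cod C f" for k
    using that f by (simp add: iso_arr_Arr)
  from this[OF g] this[OF h] eq show ?thesis by simp
qed

lemma iso_arr_Comp:
  assumes "iso_arr C f" "iso_arr C g" "Dom C g = Cod C f"
  shows "iso_arr C (g \<cdot> f)"
  by (rule iso_arrI[of _ "inv_arr C f \<cdot> inv_arr C g"])
    (use assms in \<open>auto simp: iso_arr_Arr inv_arr_Comp_Comp Comp_inv_arr_Comp\<close>)

lemma iso_arr_left_factor:
  assumes "iso_arr C (g \<cdot> f)" "iso_arr C f" "g \<in> Arr C" "Dom C g = Cod C f"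
  shows "iso_arr C g"
proof -
  have "iso_arr C ((g \<cdot> f) \<cdot> inv_arr C f)"
    by (rule iso_arr_Comp) (use assms in \<open>auto simp: iso_arr_inv_arr iso_arr_Arr\<close>)
  then show ?thesis using assms by (simp add: iso_arr_Arr)
qed

lemma iso_arr_right_factor:
  assumes "iso_arr C (g \<cdot> f)" "iso_arr C g" "f \<in> Arr C" "Dom C g = Cod C f"
  shows "iso_arr C f"
proof -
  have "iso_arr C (inv_arr C g \<cdot> (g \<cdot> f))"
    by (rule iso_arr_Comp) (use assms in \<open>auto simp: iso_arr_inv_arr iso_arr_Arr\<close>)
  then show ?thesis using assms by (simp add: inv_arr_Comp_Comp)
qed

lemma mono_arr_Arr: "mono_arr C m \<Longrightarrow> m \<in> Arr C"
  by (simp add: mono_arr_def)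

lemma mono_arr_cancel:
  assumes "mono_arr C m" "f \<in> Arr C" "g \<in> Arr C" "Cod C f = Dom C m" "Cod C g = Dom C m"
    "Dom C f = Dom C g" "m \<cdot> f = m \<cdot> g"
  shows "f = g"
proof -
  have "f \<in> hom C (Dom C g) (Dom C m)" "g \<in> hom C (Dom C g) (Dom C m)" "Dom C g \<in> Obj C"
    using assms by (auto simp: in_hom_iff)
  then show ?thesis using assms(1,7) unfolding mono_arr_def by blast
qed

lemma mono_arr_Comp_iso:
  assumes m: "mono_arr C m" and f: "iso_arr C f" "Dom C m = Cod C f"
  shows "mono_arr C (m \<cdot> f)"
proof -
  have A: "m \<in> Arr C" "f \<in> Arr C" using m f by (auto simp: mono_arr_Arr iso_arr_Arr)
  have "g = h" if "g \<in> Arr C" "h \<in> Arr C" "Dom C g = Dom C h" "Cod C g = Dom C f"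
      "Cod C h = Dom C f" "(m \<cdot> f) \<cdot> g = (m \<cdot> f) \<cdot> h" for g h
  proof -
    have "m \<cdot> (f \<cdot> g) = m \<cdot> (f \<cdot> h)"
      using that(6) Comp_assoc_Arr[of g f m] Comp_assoc_Arr[of h f m] that(1-5) A f(2) by metis
    then have "f \<cdot> g = f \<cdot> h"
      by (rule mono_arr_cancel[OF m, rotated -1]) (use that(1-5) A f(2) in auto)
    then show ?thesis
      by (rule iso_arr_cancel_left[OF f(1), rotated -1]) (use that(1-5) in auto)
  qed
  then show ?thesis using A f by (auto simp: mono_arr_def in_hom_iff)
qed

lemma factors_through_refl: "m \<in> Arr C \<Longrightarrow> factors_through C m m"
  unfolding factors_through_def by (rule bexI[of _ "Ident C (Dom C m)"]) (auto simp: in_hom_iff)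

lemma factors_through_trans:
  assumes "n \<in> Arr C" "k \<in> Arr C" "factors_through C m n" "factors_through C n k"
  shows "factors_through C m k"
proof -
  obtain h where h: "h \<in> hom C (Dom C m) (Dom C n)" "n \<cdot> h = m"
    using assms by (auto simp: factors_through_def)
  obtain l where l: "l \<in> hom C (Dom C n) (Dom C k)" "k \<cdot> l = n"
    using assms by (auto simp: factors_through_def)
  have "k \<cdot> (l \<cdot> h) = (k \<cdot> l) \<cdot> h"
    using assms h(1) l(1) by (subst Comp_assoc_Arr) (auto simp: in_hom_iff)
  also have "\<dots> = m" by (simp only: l(2) h(2))
  finally have "k \<cdot> (l \<cdot> h) = m" .
  moreover have "l \<cdot> h \<in> hom C (Dom C m) (Dom C k)"
    using h(1) l(1) by (auto simp: in_hom_iff)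
  ultimately show ?thesis unfolding factors_through_def by blast
qed

lemma equiv_subobject_rel: "equiv (monos_into C A) (subobject_rel C A)"
proof (rule equivI)
  show "subobject_rel C A \<subseteq> monos_into C A \<times> monos_into C A"
    by (auto simp: subobject_rel_def)
  show "refl_on (monos_into C A) (subobject_rel C A)"
    by (auto simp: refl_on_def subobject_rel_def monos_into_def mono_arr_Arr
        intro: factors_through_refl)
  show "sym (subobject_rel C A)"
    by (auto simp: sym_def subobject_rel_def)
  show "trans (subobject_rel C A)"
    unfolding trans_def subobject_rel_def monos_into_def
    by (auto intro: factors_through_trans mono_arr_Arr)
qed

text \<open>The two factorizations are mutually inverse because \<open>m\<close> and \<open>n\<close> can be cancelled.\<close>

lemma subobject_rel_iso_factor:
  assumes "(m, n) \<in> subobject_rel C A"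
  obtains h where "iso_arr C h" "Dom C h = Dom C m" "Cod C h = Dom C n" "m = n \<cdot> h"
proof -
  have mono: "mono_arr C m" "mono_arr C n" and Arr: "m \<in> Arr C" "n \<in> Arr C"
    using assms by (auto simp: subobject_rel_def monos_into_def mono_arr_Arr)
  obtain h k where h: "h \<in> Arr C" "Dom C h = Dom C m" "Cod C h = Dom C n" "n \<cdot> h = m"
    and k: "k \<in> Arr C" "Dom C k = Dom C n" "Cod C k = Dom C m" "m \<cdot> k = n"
    using assms by (auto simp: subobject_rel_def factors_through_def in_hom_iff)
  have "m \<cdot> (k \<cdot> h) = (m \<cdot> k) \<cdot> h" using h k Arr by (subst Comp_assoc_Arr) auto
  then have "m \<cdot> (k \<cdot> h) = m \<cdot> Ident C (Dom C m)" using h k Arr by simp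
  then have kh: "k \<cdot> h = Ident C (Dom C m)"
    by (rule mono_arr_cancel[OF mono(1), rotated -1]) (use h k Arr in auto)
  have "n \<cdot> (h \<cdot> k) = (n \<cdot> h) \<cdot> k" using h k Arr by (subst Comp_assoc_Arr) auto
  then have "n \<cdot> (h \<cdot> k) = n \<cdot> Ident C (Dom C n)" using h k Arr by simp
  then have hk: "h \<cdot> k = Ident C (Dom C n)"
    by (rule mono_arr_cancel[OF mono(2), rotated -1]) (use h k Arr in auto)
  have "iso_arr C h" by (rule iso_arrI[of _ k]) (use h k kh hk in auto)
  with h that show ?thesis by metis
qed

end

section \<open>Coherence of the unit constraints\<close>

context braided_monoidal_category
begin

declare TensorO_in_Obj [simp] Unit_in_Obj [simp] TensorA_Ident [simp]
  Assoc_iso [simp] LUnit_iso [simp] RUnit_iso [simp]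

lemma TensorA_simps [simp]:
  assumes "f \<in> Arr C" "g \<in> Arr C"
  shows "f \<boxtimes> g \<in> Arr C" "Dom C (f \<boxtimes> g) = Dom C f \<otimes> Dom C g"
    "Cod C (f \<boxtimes> g) = Cod C f \<otimes> Cod C g"
  using TensorA_in_hom[of f "Dom C f" "Cod C f" g "Dom C g" "Cod C g"] assms
  by (auto simp: in_hom_iff)

lemma Assoc_simps [simp]:
  assumes "X \<in> Obj C" "Y \<in> Obj C" "Z \<in> Obj C"
  shows "Assoc C X Y Z \<in> Arr C" "Dom C (Assoc C X Y Z) = (X \<otimes> Y) \<otimes> Z"
    "Cod C (Assoc C X Y Z) = X \<otimes> (Y \<otimes> Z)"
  using Assoc_in_hom[OF assms] by (auto simp: in_hom_iff)

lemma Unit_constraint_simps [simp]: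
  assumes "X \<in> Obj C"
  shows "LUnit C X \<in> Arr C" "Dom C (LUnit C X) = \<one> \<otimes> X" "Cod C (LUnit C X) = X"
    "RUnit C X \<in> Arr C" "Dom C (RUnit C X) = X \<otimes> \<one>" "Cod C (RUnit C X) = X"
  using LUnit_in_hom[OF assms] RUnit_in_hom[OF assms] by (auto simp: in_hom_iff)

lemma interchange:
  assumes "f \<in> Arr C" "g \<in> Arr C" "f' \<in> Arr C" "g' \<in> Arr C"
    "Dom C g = Cod C f" "Dom C g' = Cod C f'"
  shows "(g \<boxtimes> g') \<cdot> (f \<boxtimes> f') = (g \<cdot> f) \<boxtimes> (g' \<cdot> f')"
  using TensorA_Comp[of f "Dom C f" "Cod C f" g "Cod C g" f' "Dom C f'" "Cod C f'" g' "Cod C g'"]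
    assms by (auto simp: in_hom_iff)

lemma interchange_Comp:
  assumes "f \<in> Arr C" "g \<in> Arr C" "f' \<in> Arr C" "g' \<in> Arr C" "h \<in> Arr C"
    "Dom C g = Cod C f" "Dom C g' = Cod C f'" "Cod C h = Dom C f \<otimes> Dom C f'"
  shows "(g \<boxtimes> g') \<cdot> ((f \<boxtimes> f') \<cdot> h) = ((g \<cdot> f) \<boxtimes> (g' \<cdot> f')) \<cdot> h"
  using assms by (simp add: interchange[symmetric])

lemma LUnit_natural_Arr:
  "f \<in> Arr C \<Longrightarrow> LUnit C (Cod C f) \<cdot> (Ident C \<one> \<boxtimes> f) = f \<cdot> LUnit C (Dom C f)"
  by (rule LUnit_natural) (auto simp: in_hom_iff)

lemma RUnit_natural_Arr:
  "f \<in> Arr C \<Longrightarrow> RUnit C (Cod C f) \<cdot> (f \<boxtimes> Ident C \<one>) = f \<cdot> RUnit C (Dom C f)"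
  by (rule RUnit_natural) (auto simp: in_hom_iff)

lemma Assoc_natural_Arr:
  assumes "f \<in> Arr C" "g \<in> Arr C" "h \<in> Arr C"
  shows "Assoc C (Cod C f) (Cod C g) (Cod C h) \<cdot> ((f \<boxtimes> g) \<boxtimes> h) =
    (f \<boxtimes> (g \<boxtimes> h)) \<cdot> Assoc C (Dom C f) (Dom C g) (Dom C h)"
  by (rule Assoc_natural) (use assms in \<open>auto simp: in_hom_iff\<close>)

lemma iso_arr_TensorA:
  assumes "iso_arr C f" "iso_arr C g"
  shows "iso_arr C (f \<boxtimes> g)"
  by (rule iso_arrI[of _ "inv_arr C f \<boxtimes> inv_arr C g"])
    (use assms in \<open>auto simp: iso_arr_Arr interchange\<close>)

text \<open>By naturality of \<open>RUnit\<close>, tensoring with the unit is conjugation by an isomorphism.\<close>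

lemma TensorA_Unit_right_faithful:
  assumes "f \<in> Arr C" "g \<in> Arr C" "Dom C f = Dom C g" "Cod C f = Cod C g"
    and eq: "f \<boxtimes> Ident C \<one> = g \<boxtimes> Ident C \<one>"
  shows "f = g"
proof (rule iso_arr_cancel_right)
  show "iso_arr C (RUnit C (Dom C f))" using assms by simp
  show "f \<cdot> RUnit C (Dom C f) = g \<cdot> RUnit C (Dom C f)"
    using RUnit_natural_Arr[of f] RUnit_natural_Arr[of g] assms by simp
qed (use assms in auto)

lemma TensorA_Unit_left_faithful:
  assumes "f \<in> Arr C" "g \<in> Arr C" "Dom C f = Dom C g" "Cod C f = Cod C g"
    and eq: "Ident C \<one> \<boxtimes> f = Ident C \<one> \<boxtimes> g"
  shows "f = g"
proof (rule iso_arr_cancel_right)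
  show "iso_arr C (LUnit C (Dom C f))" using assms by simp
  show "f \<cdot> LUnit C (Dom C f) = g \<cdot> LUnit C (Dom C f)"
    using LUnit_natural_Arr[of f] LUnit_natural_Arr[of g] assms by simp
qed (use assms in auto)

text \<open>Kelly's argument: after tensoring with the unit on the right, this is the pentagon for
  \<open>X, Y, \<one>, \<one>\<close> with both copies of the triangle filled in.\<close>

lemma RUnit_TensorO:
  assumes X: "X \<in> Obj C" and Y: "Y \<in> Obj C"
  shows "RUnit C (X \<otimes> Y) = (Ident C X \<boxtimes> RUnit C Y) \<cdot> Assoc C X Y \<one>"
proof (rule TensorA_Unit_right_faithful)
  let ?l = "Ident C X \<boxtimes> (Ident C Y \<boxtimes> LUnit C \<one>)"
  let ?a = "Assoc C X Y \<one>"
  note [simp] = X Y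
  have "?a \<cdot> (RUnit C (X \<otimes> Y) \<boxtimes> Ident C \<one>) =
      ?a \<cdot> ((Ident C X \<boxtimes> Ident C Y) \<boxtimes> LUnit C \<one>) \<cdot> Assoc C (X \<otimes> Y) \<one> \<one>"
    by (simp add: triangle)
  also have "\<dots> = (?a \<cdot> ((Ident C X \<boxtimes> Ident C Y) \<boxtimes> LUnit C \<one>)) \<cdot> Assoc C (X \<otimes> Y) \<one> \<one>"
    by (simp del: TensorA_Ident)
  also have "?a \<cdot> ((Ident C X \<boxtimes> Ident C Y) \<boxtimes> LUnit C \<one>) = ?l \<cdot> Assoc C X Y (\<one> \<otimes> \<one>)"
    using Assoc_natural_Arr[of "Ident C X" "Ident C Y" "LUnit C \<one>"] by (simp del: TensorA_Ident)
  also have "(?l \<cdot> Assoc C X Y (\<one> \<otimes> \<one>)) \<cdot> Assoc C (X \<otimes> Y) \<one> \<one> =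
      ?l \<cdot> (Ident C X \<boxtimes> Assoc C Y \<one> \<one>) \<cdot> Assoc C X (Y \<otimes> \<one>) \<one> \<cdot> (?a \<boxtimes> Ident C \<one>)"
    by (simp add: pentagon)
  also have "\<dots> = (Ident C X \<boxtimes> (RUnit C Y \<boxtimes> Ident C \<one>)) \<cdot>
      Assoc C X (Y \<otimes> \<one>) \<one> \<cdot> (?a \<boxtimes> Ident C \<one>)"
    by (simp add: interchange_Comp triangle)
  also have "\<dots> = ((Ident C X \<boxtimes> (RUnit C Y \<boxtimes> Ident C \<one>)) \<cdot>
      Assoc C X (Y \<otimes> \<one>) \<one>) \<cdot> (?a \<boxtimes> Ident C \<one>)"
    by simp
  also have "(Ident C X \<boxtimes> (RUnit C Y \<boxtimes> Ident C \<one>)) \<cdot> Assoc C X (Y \<otimes> \<one>) \<one> =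
      ?a \<cdot> ((Ident C X \<boxtimes> RUnit C Y) \<boxtimes> Ident C \<one>)"
    using Assoc_natural_Arr[of "Ident C X" "RUnit C Y" "Ident C \<one>"] by simp
  also have "\<dots> \<cdot> (?a \<boxtimes> Ident C \<one>) =
      ?a \<cdot> (((Ident C X \<boxtimes> RUnit C Y) \<cdot> ?a) \<boxtimes> Ident C \<one>)"
    by (simp add: interchange)
  finally show "RUnit C (X \<otimes> Y) \<boxtimes> Ident C \<one> =
      ((Ident C X \<boxtimes> RUnit C Y) \<cdot> ?a) \<boxtimes> Ident C \<one>"
    by (rule iso_arr_cancel_left[rotated -1]) auto
qed (use assms in auto)

text \<open>Naturality gives \<open>RUnit (\<one> \<otimes> \<one>) = RUnit \<one> \<otimes> \<one>\<close>; comparing the previous lemma with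
  the triangle, both at \<open>\<one>, \<one>\<close>, leaves \<open>\<one> \<otimes> LUnit \<one> = \<one> \<otimes> RUnit \<one>\<close>.\<close>

lemma LUnit_Unit_eq_RUnit_Unit: "LUnit C \<one> = RUnit C \<one>"
proof (rule TensorA_Unit_left_faithful)
  have "RUnit C \<one> \<cdot> (RUnit C \<one> \<boxtimes> Ident C \<one>) = RUnit C \<one> \<cdot> RUnit C (\<one> \<otimes> \<one>)"
    using RUnit_natural_Arr[of "RUnit C \<one>"] by simp
  then have "RUnit C \<one> \<boxtimes> Ident C \<one> = RUnit C (\<one> \<otimes> \<one>)"
    by (rule iso_arr_cancel_left[rotated -1]) auto
  then have "(Ident C \<one> \<boxtimes> LUnit C \<one>) \<cdot> Assoc C \<one> \<one> \<one> =
      (Ident C \<one> \<boxtimes> RUnit C \<one>) \<cdot> Assoc C \<one> \<one> \<one>"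
    by (simp add: triangle RUnit_TensorO)
  then show "Ident C \<one> \<boxtimes> LUnit C \<one> = Ident C \<one> \<boxtimes> RUnit C \<one>"
    by (rule iso_arr_cancel_right[rotated -1]) auto
qed auto

section \<open>The contraction along an arrow into the unit\<close>

definition contract :: "'a \<Rightarrow> 'o \<Rightarrow> 'a"
  where "contract s A = RUnit C A \<cdot> (Ident C A \<boxtimes> s)"

lemma contract_simps [simp]:
  assumes "s \<in> Arr C" "Cod C s = \<one>" "A \<in> Obj C"
  shows "contract s A \<in> Arr C" "Dom C (contract s A) = A \<otimes> Dom C s" "Cod C (contract s A) = A"
  using assms by (auto simp: contract_def)

lemma contract_natural:
  assumes "s \<in> Arr C" "Cod C s = \<one>" "f \<in> Arr C"
  shows "contract s (Cod C f) \<cdot> (f \<boxtimes> Ident C (Dom C s)) = f \<cdot> contract s (Dom C f)"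
proof -
  have "contract s (Cod C f) \<cdot> (f \<boxtimes> Ident C (Dom C s)) =
      RUnit C (Cod C f) \<cdot> (f \<boxtimes> Ident C \<one>) \<cdot> (Ident C (Dom C f) \<boxtimes> s)"
    using assms by (simp add: contract_def interchange)
  also have "\<dots> = (RUnit C (Cod C f) \<cdot> (f \<boxtimes> Ident C \<one>)) \<cdot> (Ident C (Dom C f) \<boxtimes> s)"
    using assms by simp
  also have "\<dots> = f \<cdot> contract s (Dom C f)"
    using assms by (simp add: RUnit_natural_Arr contract_def)
  finally show ?thesis .
qed

lemma contract_TensorO:
  assumes s: "s \<in> Arr C" "Cod C s = \<one>" and "A \<in> Obj C" "B \<in> Obj C"
  shows "contract s (A \<otimes> B) = (Ident C A \<boxtimes> contract s B) \<cdot> Assoc C A B (Dom C s)"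
proof -
  note [simp] = assms
  have "contract s (A \<otimes> B) =
      (Ident C A \<boxtimes> RUnit C B) \<cdot> (Assoc C A B \<one> \<cdot> ((Ident C A \<boxtimes> Ident C B) \<boxtimes> s))"
    by (simp add: contract_def RUnit_TensorO)
  also have "Assoc C A B \<one> \<cdot> ((Ident C A \<boxtimes> Ident C B) \<boxtimes> s) =
      (Ident C A \<boxtimes> (Ident C B \<boxtimes> s)) \<cdot> Assoc C A B (Dom C s)"
    using Assoc_natural_Arr[of "Ident C A" "Ident C B" s] by (simp del: TensorA_Ident)
  finally show ?thesis by (simp add: contract_def interchange_Comp)
qed

lemma contract_TensorA_Ident:
  assumes s: "s \<in> Arr C" "Cod C s = \<one>" and "A \<in> Obj C" "B \<in> Obj C"
  shows "contract s A \<boxtimes> Ident C B =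
    (Ident C A \<boxtimes> (LUnit C B \<cdot> (s \<boxtimes> Ident C B))) \<cdot> Assoc C A (Dom C s) B"
proof -
  note [simp] = assms
  have "contract s A \<boxtimes> Ident C B =
      (RUnit C A \<boxtimes> Ident C B) \<cdot> ((Ident C A \<boxtimes> s) \<boxtimes> Ident C B)"
    by (simp add: contract_def interchange)
  also have "\<dots> = (Ident C A \<boxtimes> LUnit C B) \<cdot>
      (Assoc C A \<one> B \<cdot> ((Ident C A \<boxtimes> s) \<boxtimes> Ident C B))"
    by (simp add: triangle[symmetric])
  also have "Assoc C A \<one> B \<cdot> ((Ident C A \<boxtimes> s) \<boxtimes> Ident C B) =
      (Ident C A \<boxtimes> (s \<boxtimes> Ident C B)) \<cdot> Assoc C A (Dom C s) B"
    using Assoc_natural_Arr[of "Ident C A" s "Ident C B"] by simp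
  finally show ?thesis by (simp add: interchange_Comp)
qed

lemma contract_Unit:
  assumes "s \<in> Arr C" "Cod C s = \<one>"
  shows "contract s \<one> = s \<cdot> LUnit C (Dom C s)"
  using LUnit_natural_Arr[of s] assms
  by (simp add: contract_def LUnit_Unit_eq_RUnit_Unit[symmetric])

text \<open>Both ways of contracting one factor of \<open>S \<otimes> S\<close> become \<open>s \<otimes> s\<close>, up to a
  unit constraint, after composing with \<open>s\<close>, because the two unit constraints agree at \<open>\<one>\<close>.\<close>

lemma contract_either_factor:
  assumes s: "mono_arr C s" "Cod C s = \<one>"
  shows "LUnit C (Dom C s) \<cdot> (s \<boxtimes> Ident C (Dom C s)) = contract s (Dom C s)"
proof (rule mono_arr_cancel[OF s(1)])
  have [simp]: "s \<in> Arr C" "Cod C s = \<one>" using s by (auto simp: mono_arr_Arr)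
  have "s \<cdot> (LUnit C (Dom C s) \<cdot> (s \<boxtimes> Ident C (Dom C s))) =
      (s \<cdot> LUnit C (Dom C s)) \<cdot> (s \<boxtimes> Ident C (Dom C s))"
    by simp
  also have "\<dots> = contract s \<one> \<cdot> (s \<boxtimes> Ident C (Dom C s))"
    by (simp add: contract_Unit)
  also have "\<dots> = s \<cdot> contract s (Dom C s)"
    using contract_natural[of s s] by simp
  finally show "s \<cdot> (LUnit C (Dom C s) \<cdot> (s \<boxtimes> Ident C (Dom C s))) = s \<cdot> contract s (Dom C s)" .
qed (use s in \<open>auto simp: mono_arr_Arr\<close>)

text \<open>When \<open>s\<close> is a subunit, this is \<open>G \<epsilon> = \<epsilon> G\<close> for the coreflection \<open>A \<mapsto> A \<otimes> S\<close>, whose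
  counit \<open>\<epsilon>\<close> is the contraction.  Naturality alone gives the equation only after composing with \<open>\<epsilon>\<close>, which need
  not be monic away from \<open>\<one>\<close>.\<close>

lemma contract_TensorO_Dom:
  assumes s: "mono_arr C s" "Cod C s = \<one>" and A: "A \<in> Obj C"
  shows "contract s A \<boxtimes> Ident C (Dom C s) = contract s (A \<otimes> Dom C s)"
  using assms
  by (simp add: contract_TensorA_Ident contract_TensorO contract_either_factor mono_arr_Arr)

section \<open>The objects supported on a subunit\<close>

definition support :: "'a \<Rightarrow> 'o set"
  where "support s = {B \<in> Obj C. iso_arr C (Ident C B \<boxtimes> s)}"

lemma in_support_iff_contract:
  assumes "s \<in> Arr C" "Cod C s = \<one>"
  shows "B \<in> support s \<longleftrightarrow> B \<in> Obj C \<and> iso_arr C (contract s B)"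
  using assms
  by (auto simp: support_def contract_def intro: iso_arr_Comp iso_arr_right_factor)

text \<open>Naturality of the braiding exchanges \<open>s \<otimes> B\<close> and \<open>B \<otimes> s\<close>.  This reconciles the
  definition of a subunit, where \<open>s\<close> acts on the left, with that of an ideal, where it acts on
  the right.\<close>

lemma in_support_iff_left:
  assumes s: "s \<in> Arr C" and B: "B \<in> Obj C"
  shows "B \<in> support s \<longleftrightarrow> iso_arr C (s \<boxtimes> Ident C B)"
proof -
  let ?S = "Dom C s" and ?I = "Cod C s"
  note [simp] = assms
  have br [simp]: "Braid C X Y \<in> Arr C" "Dom C (Braid C X Y) = X \<otimes> Y"
      "Cod C (Braid C X Y) = Y \<otimes> X" "iso_arr C (Braid C X Y)"
    if "X \<in> Obj C" "Y \<in> Obj C" for X Y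
    using Braid_in_hom[OF that] Braid_iso[OF that] by (auto simp: in_hom_iff)
  have nat: "Braid C ?I B \<cdot> (s \<boxtimes> Ident C B) = (Ident C B \<boxtimes> s) \<cdot> Braid C ?S B"
    by (rule Braid_natural) (auto simp: in_hom_iff)
  show ?thesis
  proof
    assume "B \<in> support s"
    then have "iso_arr C (Braid C ?I B \<cdot> (s \<boxtimes> Ident C B))"
      unfolding nat by (intro iso_arr_Comp) (auto simp: support_def)
    then show "iso_arr C (s \<boxtimes> Ident C B)" by (rule iso_arr_right_factor) auto
  next
    assume "iso_arr C (s \<boxtimes> Ident C B)"
    then have "iso_arr C ((Ident C B \<boxtimes> s) \<cdot> Braid C ?S B)"
      unfolding nat[symmetric] by (intro iso_arr_Comp) auto
    then have "iso_arr C (Ident C B \<boxtimes> s)" by (rule iso_arr_left_factor) auto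
    then show "B \<in> support s" by (simp add: support_def)
  qed
qed

lemma represents_subunit_iff:
  "represents_subunit C s \<longleftrightarrow> mono_arr C s \<and> Cod C s = \<one> \<and> Dom C s \<in> support s"
  using in_support_iff_left[of s "Dom C s"]
  by (auto simp: represents_subunit_def monos_into_def mono_arr_Arr)

lemma support_TensorO:
  assumes s: "s \<in> Arr C" "Cod C s = \<one>" and A: "A \<in> Obj C" and B: "B \<in> support s"
  shows "A \<otimes> B \<in> support s"
  using assms
  by (auto simp: in_support_iff_contract contract_TensorO
      intro!: iso_arr_Comp iso_arr_TensorA iso_arr_Ident)

text \<open>Contraction is natural, so along an isomorphism one contraction is a conjugate of the
  other.\<close>

lemma support_iso_closed:
  assumes s: "s \<in> Arr C" "Cod C s = \<one>" and f: "iso_arr C f" and D: "Dom C f \<in> support s"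
  shows "Cod C f \<in> support s"
proof -
  have [simp]: "s \<in> Arr C" "Cod C s = \<one>" "f \<in> Arr C" using s f by (auto simp: iso_arr_Arr)
  have "iso_arr C (f \<cdot> contract s (Dom C f))"
    using D f by (intro iso_arr_Comp) (auto simp: in_support_iff_contract)
  then have "iso_arr C (contract s (Cod C f) \<cdot> (f \<boxtimes> Ident C (Dom C s)))"
    by (simp add: contract_natural)
  then have "iso_arr C (contract s (Cod C f))"
    by (rule iso_arr_left_factor) (auto intro!: iso_arr_TensorA f iso_arr_Ident)
  then show ?thesis by (simp add: in_support_iff_contract)
qed

lemma support_Comp_iso:
  assumes n: "n \<in> Arr C" and h: "iso_arr C h" "Cod C h = Dom C n"
  shows "support (n \<cdot> h) = support n"
proof -
  have "iso_arr C (Ident C B \<boxtimes> (n \<cdot> h)) \<longleftrightarrow> iso_arr C (Ident C B \<boxtimes> n)" if B: "B \<in> Obj C" for B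
  proof -
    have [simp]: "h \<in> Arr C" using h by (auto simp: iso_arr_Arr)
    have eq: "Ident C B \<boxtimes> (n \<cdot> h) = (Ident C B \<boxtimes> n) \<cdot> (Ident C B \<boxtimes> h)"
      using assms B by (simp add: interchange)
    have iso: "iso_arr C (Ident C B \<boxtimes> h)" using B h by (intro iso_arr_TensorA iso_arr_Ident)
    show ?thesis unfolding eq
      using assms B iso by (auto intro: iso_arr_Comp iso_arr_left_factor)
  qed
  then show ?thesis by (auto simp: support_def)
qed

lemma support_eq_of_subobject_rel:
  assumes "(m, n) \<in> subobject_rel C \<one>"
  shows "support m = support n"
proof -
  obtain h where "iso_arr C h" "Cod C h = Dom C n" "m = n \<cdot> h"
    using subobject_rel_iso_factor[OF assms] by metis
  moreover have "n \<in> Arr C"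
    using assms by (auto simp: subobject_rel_def monos_into_def mono_arr_Arr)
  ultimately show ?thesis using support_Comp_iso by simp
qed

text \<open>The support of \<open>t\<close> remembers \<open>t\<close>: if \<open>contract t S\<close> is invertible, where
  \<open>S\<close> is the domain of \<open>s\<close>, then its inverse \<open>S \<rightarrow> S \<otimes> T\<close> followed by contraction of \<open>S\<close>
  along \<open>s\<close> is the factorization \<open>S \<rightarrow> T\<close>.\<close>

lemma factors_through_if_Dom_in_support:
  assumes s: "s \<in> Arr C" "Cod C s = \<one>" and t: "t \<in> Arr C" "Cod C t = \<one>"
    and S: "Dom C s \<in> support t"
  shows "factors_through C s t"
proof -
  let ?S = "Dom C s" and ?T = "Dom C t"
  let ?c = "contract t ?S"
  have c: "iso_arr C ?c" using S t by (simp add: in_support_iff_contract)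
  note [simp] = s t c
  define h where "h = (LUnit C ?T \<cdot> (s \<boxtimes> Ident C ?T)) \<cdot> inv_arr C ?c"
  have h: "h \<in> hom C ?S ?T" by (simp add: h_def in_hom_iff)
  have "t \<cdot> h = ((t \<cdot> LUnit C ?T) \<cdot> (s \<boxtimes> Ident C ?T)) \<cdot> inv_arr C ?c"
    by (simp add: h_def)
  also have "(t \<cdot> LUnit C ?T) \<cdot> (s \<boxtimes> Ident C ?T) = s \<cdot> ?c"
    using contract_natural[of t s] by (simp add: contract_Unit)
  also have "(s \<cdot> ?c) \<cdot> inv_arr C ?c = s" by simp
  finally show ?thesis using h unfolding factors_through_def by blast
qed

end

section \<open>Subunits and monocoreflective tensor ideals\<close>

definition full_subcategory_on :: "('o, 'a, 'm) category_scheme \<Rightarrow> 'o set \<Rightarrow> 'o set \<times> 'a set"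
  where "full_subcategory_on C U = (U, {f \<in> Arr C. Dom C f \<in> U \<and> Cod C f \<in> U})"

lemma full_subcategory_eq:
  assumes "full_subcategory C D"
  shows "D = full_subcategory_on C (fst D)"
proof -
  have "snd D \<subseteq> Arr C" "\<And>f. f \<in> snd D \<Longrightarrow> Dom C f \<in> fst D \<and> Cod C f \<in> fst D"
    using assms unfolding full_subcategory_def subcategory_def by blast+
  moreover have "f \<in> snd D" if "f \<in> Arr C" "Dom C f \<in> fst D" "Cod C f \<in> fst D" for f
    using assms that unfolding full_subcategory_def hom_def by blast
  ultimately have "snd D = {f \<in> Arr C. Dom C f \<in> fst D \<and> Cod C f \<in> fst D}" by blast
  then show ?thesis by (simp add: full_subcategory_on_def prod_eq_iff)
qed

lemma subcat_simps [simp]: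
  "Obj (subcat C D) = fst D" "Arr (subcat C D) = snd D" "Dom (subcat C D) = Dom C"
  "Cod (subcat C D) = Cod C" "Ident (subcat C D) = Ident C" "Comp (subcat C D) = Comp C"
  by (simp_all add: subcat_def)

context category
begin

lemma full_subcategory_full_subcategory_on:
  "U \<subseteq> Obj C \<Longrightarrow> full_subcategory C (full_subcategory_on C U)"
  by (auto simp: full_subcategory_def subcategory_def full_subcategory_on_def in_hom_iff subset_iff)

lemma category_subcat:
  assumes "subcategory C D"
  shows "category (subcat C D)"
proof -
  have D: "fst D \<subseteq> Obj C" "snd D \<subseteq> Arr C"
    "\<And>f. f \<in> snd D \<Longrightarrow> Dom C f \<in> fst D \<and> Cod C f \<in> fst D"
    "\<And>X. X \<in> fst D \<Longrightarrow> Ident C X \<in> snd D"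
    "\<And>f g. f \<in> snd D \<Longrightarrow> g \<in> snd D \<Longrightarrow> Cod C f = Dom C g \<Longrightarrow> g \<cdot> f \<in> snd D"
    using assms unfolding subcategory_def by blast+
  show ?thesis
    by unfold_locales (use D in \<open>auto simp: in_hom_iff subset_iff\<close>)
qed

end

context braided_monoidal_category
begin

text \<open>The right adjoint is tensoring with \<open>S\<close> and its counit is contraction.  The unit at a
  supported object is the inverse of the contraction.  One triangle identity is then trivial; the
  other says that contracting the old or the new factor of \<open>(A \<otimes> S) \<otimes> S\<close> is the same.\<close>

lemma adjunction_contract:
  fixes s
  defines "D \<equiv> full_subcategory_on C (support s)"
  defines "G \<equiv> \<lparr>on_obj = (\<lambda>A. A \<otimes> Dom C s), on_arr = (\<lambda>f. f \<boxtimes> Ident C (Dom C s))\<rparr>"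
  assumes "represents_subunit C s"
  shows "adjunction (subcat C D) C inclusion_functor G (\<lambda>B. inv_arr C (contract s B)) (contract s)"
proof -
  have s: "mono_arr C s" "s \<in> Arr C" "Cod C s = \<one>" "Dom C s \<in> support s"
    using assms by (auto simp: represents_subunit_iff mono_arr_Arr)
  note [simp] = s(2,3)
  have U: "support s \<subseteq> Obj C" by (auto simp: support_def)
  have cat: "category C" "category (subcat C D)"
    using category_subcat full_subcategory_full_subcategory_on[OF U]
    by (auto simp: D_def full_subcategory_def intro: category_axioms)
  have supp [simp]: "iso_arr C (contract s B)" "B \<in> Obj C" if "B \<in> support s" for B
    using that by (auto simp: in_support_iff_contract)
  have tens [simp]: "A \<otimes> Dom C s \<in> support s" if "A \<in> Obj C" for A
    using support_TensorO that s by simp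
  have D [simp]: "fst D = support s" "snd D = {f \<in> Arr C. Dom C f \<in> support s \<and> Cod C f \<in> support s}"
    by (simp_all add: D_def full_subcategory_on_def)
  have F: "is_functor (subcat C D) C inclusion_functor"
    using cat by (auto simp: is_functor_def inclusion_functor_def in_hom_iff)
  have G: "is_functor C (subcat C D) G"
    using cat by (auto simp: is_functor_def G_def in_hom_iff interchange)
  have eps: "nat_trans C C (comp_functor inclusion_functor G) id_functor (contract s)"
    using cat contract_natural
    by (auto simp: nat_trans_def is_functor_def comp_functor_def inclusion_functor_def id_functor_def
        G_def in_hom_iff interchange)
  have eta_nat: "inv_arr C (contract s (Cod C f)) \<cdot> f =
      (f \<boxtimes> Ident C (Dom C s)) \<cdot> inv_arr C (contract s (Dom C f))"
    if f: "f \<in> Arr C" "Dom C f \<in> support s" "Cod C f \<in> support s" for f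
  proof (rule iso_arr_cancel_left[of "contract s (Cod C f)"])
    have "contract s (Cod C f) \<cdot> ((f \<boxtimes> Ident C (Dom C s)) \<cdot> inv_arr C (contract s (Dom C f))) =
        (contract s (Cod C f) \<cdot> (f \<boxtimes> Ident C (Dom C s))) \<cdot> inv_arr C (contract s (Dom C f))"
      using f by simp
    also have "\<dots> = f" using f by (simp add: contract_natural)
    finally show "contract s (Cod C f) \<cdot> (inv_arr C (contract s (Cod C f)) \<cdot> f) =
        contract s (Cod C f) \<cdot> ((f \<boxtimes> Ident C (Dom C s)) \<cdot> inv_arr C (contract s (Dom C f)))"
      using f by (simp add: Comp_inv_arr_Comp)
  qed (use f in auto)
  have eta: "nat_trans (subcat C D) (subcat C D) id_functor (comp_functor G inclusion_functor)
      (\<lambda>B. inv_arr C (contract s B))"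
    using cat eta_nat
    by (auto simp: nat_trans_def is_functor_def comp_functor_def inclusion_functor_def id_functor_def
        G_def in_hom_iff interchange)
  have "on_arr G (contract s A) \<cdot> inv_arr C (contract s (on_obj G A)) = Ident C (on_obj G A)"
    if "A \<in> Obj C" for A
    using that s by (simp add: G_def contract_TensorO_Dom)
  then show ?thesis using F G eps eta
    by (auto simp: adjunction_def inclusion_functor_def)
qed

lemma monocoreflective_tensor_ideal_support:
  assumes "represents_subunit C s"
  shows "monocoreflective_tensor_ideal C (full_subcategory_on C (support s))"
proof -
  let ?D = "full_subcategory_on C (support s)"
  have s: "mono_arr C s" "s \<in> Arr C" "Cod C s = \<one>"
    using assms by (auto simp: represents_subunit_iff mono_arr_Arr)
  note [simp] = s(2,3)
  have full: "full_subcategory C ?D"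
    by (rule full_subcategory_full_subcategory_on) (auto simp: support_def)
  then have repl: "replete_subcategory C ?D"
    using support_iso_closed[of s]
    by (auto simp: replete_subcategory_def full_subcategory_def full_subcategory_on_def iso_arr_Arr)
  have ideal: "\<forall>A \<in> Obj C. \<forall>B \<in> fst ?D. A \<otimes> B \<in> fst ?D"
    using support_TensorO by (simp add: full_subcategory_on_def)
  have mono: "mono_arr C (contract s \<one>)"
    using s by (simp add: contract_Unit mono_arr_Comp_iso)
  have "support (contract s \<one>) = support s"
    by (simp add: contract_Unit support_Comp_iso)
  then have "\<forall>B \<in> fst ?D. iso_arr C (Ident C B \<boxtimes> contract s \<one>)"
    by (auto simp: full_subcategory_on_def support_def)
  with full repl ideal mono adjunction_contract[OF assms] show ?thesis
    unfolding monocoreflective_tensor_ideal_def Let_def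
    by (auto simp: inclusion_functor_def)
qed

text \<open>The subunit of an ideal is its counit at \<open>\<one>\<close>.  An object \<open>B\<close> with \<open>B \<otimes> \<epsilon>\<close>
  invertible is isomorphic to \<open>B \<otimes> S\<close>, which lies in the ideal because \<open>S\<close> does.\<close>

lemma monocoreflective_tensor_ideal_cases:
  assumes D: "monocoreflective_tensor_ideal C D"
  obtains s where "represents_subunit C s" "D = full_subcategory_on C (support s)"
proof -
  have full: "full_subcategory C D" and repl: "replete_subcategory C D"
    and ideal: "\<And>A B. A \<in> Obj C \<Longrightarrow> B \<in> fst D \<Longrightarrow> A \<otimes> B \<in> fst D"
    using D by (auto simp: monocoreflective_tensor_ideal_def)
  obtain G \<eta> \<epsilon> where adj: "adjunction (subcat C D) C inclusion_functor G \<eta> \<epsilon>"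
    and mono: "mono_arr C (\<epsilon> \<one>)"
    and iso: "\<And>B. B \<in> fst D \<Longrightarrow> iso_arr C (Ident C B \<boxtimes> \<epsilon> \<one>)"
    using D by (auto simp: monocoreflective_tensor_ideal_def Let_def inclusion_functor_def)
  let ?s = "\<epsilon> \<one>"
  have "?s \<in> hom C (on_obj G \<one>) \<one>" and S: "on_obj G \<one> \<in> fst D"
    using adj by (auto simp: adjunction_def nat_trans_def is_functor_def comp_functor_def
        id_functor_def inclusion_functor_def)
  then have s: "?s \<in> Arr C" "Cod C ?s = \<one>" "Dom C ?s \<in> fst D" by (auto simp: in_hom_iff)
  have Obj: "fst D \<subseteq> Obj C" using full by (auto simp: full_subcategory_def subcategory_def)
  have "B \<in> fst D" if B: "B \<in> support ?s" for B
  proof -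
    have "B \<otimes> Dom C ?s \<in> fst D" using ideal B s by (auto simp: support_def)
    moreover have "iso_arr C (contract ?s B)" "B \<in> Obj C"
      using B s by (auto simp: in_support_iff_contract)
    ultimately show ?thesis
      using repl s unfolding replete_subcategory_def by (metis contract_simps(2,3))
  qed
  then have supp: "support ?s = fst D" using iso Obj by (auto simp: support_def)
  show ?thesis
  proof (rule that)
    show "represents_subunit C ?s" using mono s supp by (simp add: represents_subunit_iff)
    show "D = full_subcategory_on C (support ?s)" using full_subcategory_eq[OF full] supp by simp
  qed
qed

end

theorem proposition4p18:
  fixes C :: "('o, 'a, 'm) braided_data_scheme"
  assumes "firm_category C"
  shows "\<exists>\<Phi>. bij_betw \<Phi> (ISub C) (monocoreflective_tensor_ideals C)"
proof -
  interpret firm_category C by (rule assms)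
  let ?R = "subobject_rel C \<one>\<^bsub>C\<^esub>"
  \<comment> \<open>All members of a class have the same support; intersecting avoids choosing a representative.\<close>
  define \<Phi> where "\<Phi> S = full_subcategory_on C (\<Inter>s\<in>S. support s)" for S
  have Phi_class: "\<Phi> (?R `` {s}) = full_subcategory_on C (support s)"
    if "represents_subunit C s" for s
  proof -
    have "s \<in> ?R `` {s}"
      using that equiv_class_self[OF equiv_subobject_rel] by (auto simp: represents_subunit_def)
    then have "(\<Inter>t \<in> ?R `` {s}. support t) = support s"
      using support_eq_of_subobject_rel by blast
    then show ?thesis by (simp add: \<Phi>_def)
  qed
  have ISub_iff: "S \<in> ISub C \<longleftrightarrow> (\<exists>s. represents_subunit C s \<and> S = ?R `` {s})" for S
  proof
    assume "S \<in> ISub C"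
    then obtain s where "represents_subunit C s" "s \<in> S" "S \<in> monos_into C \<one>\<^bsub>C\<^esub> // ?R"
      by (auto simp: ISub_def subobjects_def)
    moreover from this have "S = ?R `` {s}"
      using Image_singleton_iff equiv_class_eq_iff[OF equiv_subobject_rel] by (auto elim!: quotientE)
    ultimately show "\<exists>s. represents_subunit C s \<and> S = ?R `` {s}" by blast
  next
    assume "\<exists>s. represents_subunit C s \<and> S = ?R `` {s}"
    then obtain s where s: "represents_subunit C s" and S: "S = ?R `` {s}" by blast
    then have "s \<in> monos_into C \<one>\<^bsub>C\<^esub>" by (simp add: represents_subunit_def)
    then show "S \<in> ISub C"
      using s S equiv_class_self[OF equiv_subobject_rel]
      by (auto simp: ISub_def subobjects_def intro: quotientI)
  qed
  have "bij_betw \<Phi> (ISub C) (monocoreflective_tensor_ideals C)"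
  proof (rule bij_betw_imageI)
    show "inj_on \<Phi> (ISub C)"
    proof (rule inj_onI)
      fix S T assume "S \<in> ISub C" "T \<in> ISub C" and eq: "\<Phi> S = \<Phi> T"
      then obtain s t where s: "represents_subunit C s" "S = ?R `` {s}"
        and t: "represents_subunit C t" "T = ?R `` {t}" by (auto simp: ISub_iff)
      have "support s = support t"
        using eq s t by (simp add: Phi_class full_subcategory_on_def)
      then have "(s, t) \<in> ?R"
        using s(1) t(1) factors_through_if_Dom_in_support
        by (auto simp: subobject_rel_def represents_subunit_iff monos_into_def mono_arr_Arr)
      then show "S = T" using s t equiv_class_eq[OF equiv_subobject_rel] by blast
    qed
    show "\<Phi> ` ISub C = monocoreflective_tensor_ideals C"
    proof (intro equalityI subsetI)
      fix D assume "D \<in> \<Phi> ` ISub C"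
      then obtain s where "represents_subunit C s" "D = full_subcategory_on C (support s)"
        by (auto simp: ISub_iff Phi_class)
      then show "D \<in> monocoreflective_tensor_ideals C"
        by (simp add: monocoreflective_tensor_ideals_def monocoreflective_tensor_ideal_support)
    next
      fix D assume "D \<in> monocoreflective_tensor_ideals C"
      then obtain s where "represents_subunit C s" "D = full_subcategory_on C (support s)"
        unfolding monocoreflective_tensor_ideals_def
        by (blast elim: monocoreflective_tensor_ideal_cases)
      then have "?R `` {s} \<in> ISub C" "D = \<Phi> (?R `` {s})" by (auto simp: ISub_iff Phi_class)
      then show "D \<in> \<Phi> ` ISub C" by blast
    qed
  qed
  then show ?thesis by blast
qed

end
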